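(* Let $P$ be a $2\times k$ zero-one matrix that does not contain a $2\times 2$ homogeneous submatrix. Then there exist a constant $c>0$ and a function $f(n)=n^{1-o(1)}$ (as $n\to\infty$) such that every $P$-free $n\times n$ zero-one matrix $A$ contains a homogeneous $f(n)\times cn$ submatrix (i.e., with $f(n)$ rows and $cn$ columns).
   Context: A matrix is homogeneous if all of its entries are equal. For a matrix $A$ and sets $X$ of rows and $Y$ of columns, $A[X\times Y]$ is the submatrix formed by these rows and columns in their original order; an $s\times t$ submatrix has $s$ rows and $t$ columns. A $k\times \ell$ matrix $P$ is contained in $A$ if there are row indices $i_1<\dots<i_k$ and column indices $j_1<\dots<j_\ell$ with $A(i_a,j_b)=P(a,b)$ for all $a,b$; $A$ is $P$-free if it does not contain $P$. Floors and ceilings are omitted. *)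

theory Defs
  imports Complex_Main "HOL-Library.Landau_Symbols"
    "Jordan_Normal_Form.Matrix" "Jordan_Normal_Form.DL_Submatrix"
begin

text \<open>Matrices are those of \<^theory>\<open>Jordan_Normal_Form.Matrix\<close>; rows and columns are
  indexed from 0.\<close>

definition zero_one_mat :: "nat mat \<Rightarrow> bool" where
  "zero_one_mat A \<longleftrightarrow> elements_mat A \<subseteq> {0, 1}"

definition homogeneous :: "'a mat \<Rightarrow> bool" where
  "homogeneous A \<longleftrightarrow> (\<forall>x \<in> elements_mat A. \<forall>y \<in> elements_mat A. x = y)"

text \<open>\<^term>\<open>submatrix A X Y\<close> silently discards indices outside the matrix, hence the explicit
  range conditions: they make the submatrix have exactly \<open>s\<close> rows and \<open>t\<close> columns.\<close>

definition has_homogeneous_submatrix :: "'a mat \<Rightarrow> nat \<Rightarrow> nat \<Rightarrow> bool" where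
  "has_homogeneous_submatrix A s t \<longleftrightarrow>
     (\<exists>X Y. X \<subseteq> {..<dim_row A} \<and> card X = s \<and> Y \<subseteq> {..<dim_col A} \<and> card Y = t \<and>
        homogeneous (submatrix A X Y))"

definition contains_mat :: "'a mat \<Rightarrow> 'a mat \<Rightarrow> bool" where
  "contains_mat A P \<longleftrightarrow>
     (\<exists>i j. strict_mono_on {..<dim_row P} i \<and> i ` {..<dim_row P} \<subseteq> {..<dim_row A} \<and>
        strict_mono_on {..<dim_col P} j \<and> j ` {..<dim_col P} \<subseteq> {..<dim_col A} \<and>
        (\<forall>a<dim_row P. \<forall>b<dim_col P. A $$ (i a, j b) = P $$ (a, b)))"

definition mat_free :: "'a mat \<Rightarrow> 'a mat \<Rightarrow> bool" where
  "mat_free P A \<longleftrightarrow> \<not> contains_mat A P"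

end

theory Submission
  imports Defs "HOL-Library.Log_Nat" "HOL-Real_Asymp.Real_Asymp"
begin

text \<open>Identify a row with its set of ones and cut the columns into boundedly many intervals. If
  some row has linearly many zeros and ones in every interval, then compare it with the later rows:
  for each of them some interval contains no copy of the corresponding column of \<open>P\<close>, and the
  pigeonhole principle gives even a linear times linear homogeneous block.

  Otherwise linearly many rows are sparse (up to complementation) on a common interval; cut it again
  into \<open>k + 1\<close> pieces. On each piece consider the inclusion order of the rows. If a row contains many
  others on a piece, these all vanish off that sparse row. If not, the argument of Fox and Pach for
  several partial orders yields sets \<open>S\<close>, \<open>T\<close> of \<open>n\<^sup>1\<^sup>-\<^sup>o\<^sup>(\<^sup>1\<^sup>)\<close> rows
  such that no row of \<open>S\<close> is comparable to one of \<open>T\<close> on any piece. Such a pair of rows shows 01, 10 and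
  00 on every piece; as \<open>P\<close> has only one column 11, \<open>P\<close>-freeness makes the two rows disjoint on the
  piece reserved for that column. Hence the union of \<open>S\<close> or that of \<open>T\<close> misses half of the piece.\<close>

section \<open>Pigeonhole principle\<close>

lemma large_fibre:
  assumes "finite A" "finite B" "B \<noteq> {}" "f ` A \<subseteq> B" "card B * q \<le> card A"
  shows "\<exists>b\<in>B. q \<le> card {a \<in> A. f a = b}"
proof (rule ccontr)
  assume "\<not> ?thesis"
  then have "card {a \<in> A. f a = b} < q" if "b \<in> B" for b
    using that by auto
  then have "(\<Sum>b\<in>B. card {a \<in> A. f a = b}) < (\<Sum>b\<in>B. q)"
    using assms by (intro sum_strict_mono) auto
  moreover have "card A = (\<Sum>b\<in>B. card {a \<in> A. f a = b})"
    using sum_fun_comp[of A B f "\<lambda>_. 1::nat"] assms by simp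
  ultimately show False using assms by simp
qed

section \<open>Unrelated sets for several transitive relations\<close>

text \<open>Endpoints of chains that start in \<open>X\<close> and take one element from each of the
  layers \<open>V 1\<close>, ..., \<open>V t\<close>. Layers are kept because the absence of an
  unrelated pair only controls the step from one block to the next.\<close>

fun chain_image :: "('a \<Rightarrow> 'a \<Rightarrow> bool) \<Rightarrow> (nat \<Rightarrow> 'a set) \<Rightarrow> nat \<Rightarrow> 'a set \<Rightarrow> 'a set" where
  "chain_image R V 0 X = X"
| "chain_image R V (Suc t) X = {y \<in> V (Suc t). \<exists>x \<in> chain_image R V t X. R x y}"

lemma chain_image_Un:
  "chain_image R V t (X \<union> Y) = chain_image R V t X \<union> chain_image R V t Y"
  by (induction t) auto

lemma chain_image_subset: "X \<subseteq> V 0 \<Longrightarrow> chain_image R V t X \<subseteq> V t"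
  by (cases t) auto

text \<open>Transitivity collapses a chain to a single relation; \<open>t > 0\<close> matters as
  \<open>R\<close> need not be reflexive.\<close>

lemma chain_image_related:
  assumes "transp R" "t > 0" "y \<in> chain_image R V t X"
  shows "\<exists>x\<in>X. R x y"
  using assms(2,3)
proof (induction t arbitrary: y)
  case (Suc t)
  then obtain z where z: "z \<in> chain_image R V t X" "R z y" by auto
  show ?case
  proof (cases "t = 0")
    case False
    with Suc z obtain x where "x \<in> X" "R x z" by blast
    with z(2) show ?thesis using transpD[OF assms(1)] by blast
  qed (use z in auto)
qed simp

lemma ex_halves:
  assumes "finite X" "card X \<le> 2 * q"
  shows "\<exists>Y Z. X = Y \<union> Z \<and> card Y \<le> q \<and> card Z \<le> q"
proof -
  obtain Y where Y: "Y \<subseteq> X" "card Y = min q (card X)"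
    using obtain_subset_with_card_n[of "min q (card X)" X] by auto
  have "X = Y \<union> (X - Y)" using Y by auto
  moreover have "card (X - Y) \<le> q"
    using Y assms by (subst card_Diff_subset) (auto intro: finite_subset)
  ultimately show ?thesis using Y by (metis min.cobounded1)
qed

text \<open>If no unrelated pair existed, images of sets of size \<open>u\<close> would always fill more than two thirds
  of the next block, so one could halve the initial set at every step and end with a single
  element related to at least \<open>u\<close> others.\<close>

lemma ex_unrelated_in_consecutive_blocks:
  fixes V :: "nat \<Rightarrow> 'a set"
  assumes R: "transp R" and W: "finite W" "card W \<le> 2 ^ h" and u: "u > 0"
    and deg: "\<And>x. x \<in> W \<Longrightarrow> card {y \<in> W. R x y} < u"
    and V: "\<And>t. t \<le> h \<Longrightarrow> V t \<subseteq> W" "\<And>t. t \<le> h \<Longrightarrow> card (V t) = 3 * u"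
  shows "\<exists>t<h. \<exists>S\<subseteq>V t. \<exists>T\<subseteq>V (Suc t). card S = u \<and> card T = u \<and> (\<forall>x\<in>S. \<forall>y\<in>T. \<not> R x y)"
proof (rule ccontr)
  assume no: "\<not> ?thesis"
  have fin: "finite (V t)" if "t \<le> h" for t
    using V(1)[OF that] W(1) by (rule finite_subset)
  \<comment> \<open>If fewer than \<open>2 * u\<close> of the \<open>3 * u\<close> elements were
    reached, \<open>u\<close> of the others and \<open>u\<close> elements of \<open>Y\<close> would
    form an unrelated pair.\<close>
  have expand: "2 * u \<le> card {y \<in> V (Suc t). \<exists>x\<in>Y. R x y}"
    if t: "t < h" and Y: "Y \<subseteq> V t" "u \<le> card Y" for t Y
  proof (rule ccontr)
    let ?I = "{y \<in> V (Suc t). \<exists>x\<in>Y. R x y}"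
    assume "\<not> 2 * u \<le> card ?I"
    then have "u \<le> card (V (Suc t) - ?I)"
      using fin[of "Suc t"] V(2)[of "Suc t"] t by (subst card_Diff_subset) auto
    then obtain T where T: "T \<subseteq> V (Suc t) - ?I" "card T = u"
      by (meson obtain_subset_with_card_n)
    obtain S where S: "S \<subseteq> Y" "card S = u"
      using Y(2) by (meson obtain_subset_with_card_n)
    have "S \<subseteq> V t" "T \<subseteq> V (Suc t)" "\<forall>x\<in>S. \<forall>y\<in>T. \<not> R x y"
      using S T Y by auto
    then show False using no t S(2) T(2) by blast
  qed
  \<comment> \<open>The bound \<open>2 ^ h\<close> for \<open>t = 0\<close> comes from
    \<open>W\<close>; afterwards the image of one of two halves keeps at least half of the
    \<open>2 * u\<close> elements reached.\<close>
  have "\<exists>X\<subseteq>V 0. card X \<le> 2 ^ (h - t) \<and> u \<le> card (chain_image R V t X)" if "t \<le> h" for t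
    using that
  proof (induction t)
    case 0
    have "card (V 0) \<le> 2 ^ h"
      using card_mono[OF W(1) V(1)[of 0]] W(2) by simp
    then show ?case using V(2)[of 0] by auto
  next
    case (Suc t)
    then obtain X where X: "X \<subseteq> V 0" "card X \<le> 2 ^ (h - t)" "u \<le> card (chain_image R V t X)"
      by auto
    have "h - t = Suc (h - Suc t)" using Suc.prems by simp
    then have "card X \<le> 2 * 2 ^ (h - Suc t)" using X(2) by simp
    then obtain Y Z where YZ: "X = Y \<union> Z" "card Y \<le> 2 ^ (h - Suc t)" "card Z \<le> 2 ^ (h - Suc t)"
      using ex_halves[OF finite_subset[OF X(1) fin[OF le0]], of "2 ^ (h - Suc t)"] by blast
    have "2 * u \<le> card (chain_image R V (Suc t) X)"
      using expand[of t "chain_image R V t X"] chain_image_subset[of X V R t] X(1,3) Suc.prems by simp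
    also have "\<dots> \<le> card (chain_image R V (Suc t) Y) + card (chain_image R V (Suc t) Z)"
      unfolding YZ(1) chain_image_Un by (rule card_Un_le)
    finally have "u \<le> card (chain_image R V (Suc t) Y) \<or> u \<le> card (chain_image R V (Suc t) Z)"
      by linarith
    then show ?case using X(1) YZ by blast
  qed
  from this[of h] obtain X where X: "X \<subseteq> V 0" "card X \<le> 1" "u \<le> card (chain_image R V h X)"
    by auto
  have finX: "finite X" using finite_subset[OF X(1)] fin[of 0] by simp
  have "chain_image R V h X \<noteq> {}" using X(3) u by auto
  moreover have "chain_image R V t {} = {}" for t by (induction t) auto
  ultimately have "X \<noteq> {}" by metis
  then have "card X = 1" using X(2) finX by (metis One_nat_def card_gt_0_iff le_antisym Suc_leI)
  then obtain x where x: "X = {x}" by (rule card_1_singletonE)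
  show False
  proof (cases "h = 0")
    case True
    then show ?thesis using W V(1,2)[of 0] u card_mono[OF W(1) V(1)[of 0]] by simp
  next
    case False
    have "chain_image R V h X \<subseteq> {y \<in> W. R x y}"
      using chain_image_related[OF R, of h _ V X] False chain_image_subset[of X V R h] X(1) V(1)[of h] x
      by auto
    then have "card (chain_image R V h X) \<le> card {y \<in> W. R x y}"
      using W(1) by (intro card_mono) auto
    with X(3) have "u \<le> card {y \<in> W. R x y}" by (rule le_trans)
    then show False using deg[of x] x X(1) V(1)[of 0] by auto
  qed
qed

text \<open>Splitting is iterated along a binary tree: each level doubles the number of blocks and
  costs a factor \<open>g\<close>. Unrelatedness is only asserted from an earlier block to a later
  one.\<close>

lemma ex_pairwise_unrelated_blocks:
  fixes W :: "'a set"
  assumes split: "\<And>V v. V \<subseteq> W \<Longrightarrow> u \<le> v \<Longrightarrow> g * v \<le> card V \<Longrightarrow>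
      \<exists>S\<subseteq>V. \<exists>T\<subseteq>V. card S = v \<and> card T = v \<and> (\<forall>x\<in>S. \<forall>y\<in>T. \<not> R x y)"
    and "g > 0" and "V \<subseteq> W" and "u \<le> v" and "g ^ d * v \<le> card V"
  shows "\<exists>B :: nat \<Rightarrow> 'a set. (\<forall>a<2^d. B a \<subseteq> V \<and> card (B a) = v) \<and>
      (\<forall>a b. a < b \<and> b < 2^d \<longrightarrow> (\<forall>x\<in>B a. \<forall>y\<in>B b. \<not> R x y))"
  using assms(3,5)
proof (induction d arbitrary: V)
  case 0
  then obtain S where "S \<subseteq> V" "card S = v" by (auto elim: obtain_subset_with_card_n)
  then show ?case by (intro exI[of _ "\<lambda>_. S"]) auto
next
  case (Suc d)
  have "v \<le> g ^ d * v" using \<open>g > 0\<close> by simp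
  then have "u \<le> g ^ d * v" using \<open>u \<le> v\<close> by (rule le_trans[rotated])
  moreover have "g * (g ^ d * v) \<le> card V" using Suc.prems by (simp add: mult.assoc)
  ultimately obtain S T where ST: "S \<subseteq> V" "T \<subseteq> V" "card S = g ^ d * v" "card T = g ^ d * v"
    "\<And>x y. x \<in> S \<Longrightarrow> y \<in> T \<Longrightarrow> \<not> R x y"
    using split[OF Suc.prems(1), of "g ^ d * v"] by blast
  have SW: "S \<subseteq> W" "T \<subseteq> W" using ST(1,2) Suc.prems(1) by auto
  have "\<exists>B :: nat \<Rightarrow> 'a set. (\<forall>a<2^d. B a \<subseteq> S \<and> card (B a) = v) \<and>
      (\<forall>a b. a < b \<and> b < 2^d \<longrightarrow> (\<forall>x\<in>B a. \<forall>y\<in>B b. \<not> R x y))"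
    using Suc.IH[OF SW(1)] ST(3) by simp
  then obtain B :: "nat \<Rightarrow> 'a set" where B: "\<forall>a<2^d. B a \<subseteq> S \<and> card (B a) = v"
    "\<forall>a b. a < b \<and> b < 2^d \<longrightarrow> (\<forall>x\<in>B a. \<forall>y\<in>B b. \<not> R x y)"
    by (elim exE conjE)
  have "\<exists>C :: nat \<Rightarrow> 'a set. (\<forall>a<2^d. C a \<subseteq> T \<and> card (C a) = v) \<and>
      (\<forall>a b. a < b \<and> b < 2^d \<longrightarrow> (\<forall>x\<in>C a. \<forall>y\<in>C b. \<not> R x y))"
    using Suc.IH[OF SW(2)] ST(4) by simp
  then obtain C :: "nat \<Rightarrow> 'a set" where C: "\<forall>a<2^d. C a \<subseteq> T \<and> card (C a) = v"
    "\<forall>a b. a < b \<and> b < 2^d \<longrightarrow> (\<forall>x\<in>C a. \<forall>y\<in>C b. \<not> R x y)"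
    by (elim exE conjE)
  \<comment> \<open>All blocks inside \<open>S\<close> are listed before those inside
    \<open>T\<close>, so mixed pairs inherit that \<open>S\<close> is unrelated to
    \<open>T\<close>.\<close>
  let ?D = "\<lambda>a. if a < 2^d then B a else C (a - 2^d)"
  have "?D a \<subseteq> V \<and> card (?D a) = v" if "a < 2 ^ Suc d" for a
  proof (cases "a < 2^d")
    case True
    then have "B a \<subseteq> S" "card (B a) = v" using B(1) by blast+
    then show ?thesis using ST(1) True by simp
  next
    case False
    then have "a - 2^d < 2^d" using that by simp
    then have "C (a - 2^d) \<subseteq> T" "card (C (a - 2^d)) = v" using C(1) by blast+
    then show ?thesis using ST(2) False by simp
  qed
  moreover have "\<not> R x y" if "a < b" "b < 2 ^ Suc d" "x \<in> ?D a" "y \<in> ?D b" for a b x y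
  proof -
    consider "b < 2^d" | "a < 2^d" "\<not> b < 2^d" | "\<not> a < 2^d" "\<not> b < 2^d" by blast
    then show ?thesis
    proof cases
      case 1
      then show ?thesis using B(2) that by simp
    next
      case 2
      then have "b - 2^d < 2^d" using that(2) by simp
      then have "B a \<subseteq> S" "C (b - 2^d) \<subseteq> T" using B(1) C(1) 2(1) by blast+
      then show ?thesis using ST(5)[of x y] that(3,4) 2 by auto
    next
      case 3
      then have "b - 2^d < 2^d" using that(2) by simp
      then show ?thesis using 3 C(2)[rule_format, of "a - 2^d" "b - 2^d" x y] that by auto
    qed
  qed
  ultimately show ?case by (intro exI[of _ ?D]) blast
qed

text \<open>The factor lost in size when \<open>r\<close> relations are treated with \<open>2 ^ d\<close> blocks per relation.\<close>

fun loss :: "nat \<Rightarrow> nat \<Rightarrow> nat" where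
  "loss d 0 = 1"
| "loss d (Suc r) = 3 * loss d r ^ d"

lemma loss_pos: "loss d r > 0"
  by (induction r) auto

text \<open>The exact exponent of 3 is the geometric sum of \<open>d ^ s\<close> over
  \<open>s < r\<close>.\<close>

lemma loss_le: "loss d r \<le> 3 ^ ((1 + d) ^ r)"
proof (induction r)
  case (Suc r)
  have "loss d (Suc r) \<le> 3 * (3 ^ ((1 + d) ^ r)) ^ d"
    using Suc by (simp add: power_mono)
  also have "\<dots> = 3 ^ (1 + d * (1 + d) ^ r)"
    by (simp add: power_mult mult.commute flip: power_mult)
  also have "\<dots> \<le> 3 ^ ((1 + d) ^ Suc r)"
    by (intro power_increasing) (auto simp: algebra_simps)
  finally show ?case .
qed simp

text \<open>Fox and Pach's theorem on several partial orders; the alternative of \<open>u\<close> elements related to a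
  single one is excluded by hypothesis. Listing both a relation and its converse in \<open>Rs\<close> gives
  incomparability.\<close>

lemma ex_unrelated:
  fixes W :: "'a set"
  assumes W: "finite W" "card W \<le> 2 ^ h" "h < 2 ^ d" and u: "u > 0"
    and Rs: "\<And>R. R \<in> set Rs \<Longrightarrow> transp R \<and>
      ((\<forall>x\<in>W. card {y \<in> W. R x y} < u) \<or> (\<forall>x\<in>W. card {y \<in> W. R y x} < u))"
    and V: "V \<subseteq> W" "u \<le> v" "loss d (length Rs) * v \<le> card V"
  shows "\<exists>S\<subseteq>V. \<exists>T\<subseteq>V. card S = v \<and> card T = v \<and> (\<forall>x\<in>S. \<forall>y\<in>T. \<not> (\<exists>R\<in>set Rs. R x y))"
  using Rs V
proof (induction Rs arbitrary: V v)
  case Nil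
  then obtain S where "S \<subseteq> V" "card S = v" by (auto elim: obtain_subset_with_card_n)
  then show ?case by auto
next
  case (Cons R Rs)
  let ?Q = "\<lambda>x y. \<exists>R\<in>set Rs. R x y"
  have v: "v > 0" using u Cons.prems(3) by simp
  have R: "transp R"
    "(\<forall>x\<in>W. card {y \<in> W. R x y} < v) \<or> (\<forall>x\<in>W. card {y \<in> W. R y x} < v)"
    using Cons.prems(1)[of R] Cons.prems(3) by force+
  \<comment> \<open>The induction hypothesis serves as the splitting step, so the blocks are already
    unrelated for \<open>Rs\<close>. Size \<open>3 * v\<close> is what \<open>R\<close> needs next;
    this explains the recursion of \<open>loss\<close>.\<close>
  have "\<exists>B :: nat \<Rightarrow> 'a set. (\<forall>a<2^d. B a \<subseteq> V \<and> card (B a) = 3 * v) \<and>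
      (\<forall>a b. a < b \<and> b < 2^d \<longrightarrow> (\<forall>x\<in>B a. \<forall>y\<in>B b. \<not> ?Q x y))"
  proof (rule ex_pairwise_unrelated_blocks[where u = u and W = W and g = "loss d (length Rs)"])
    fix V' v' assume "V' \<subseteq> W" "u \<le> v'" "loss d (length Rs) * v' \<le> card V'"
    then show "\<exists>S\<subseteq>V'. \<exists>T\<subseteq>V'. card S = v' \<and> card T = v' \<and> (\<forall>x\<in>S. \<forall>y\<in>T. \<not> ?Q x y)"
      using Cons.IH[of V' v'] Cons.prems(1) by simp
  qed (use Cons.prems loss_pos in \<open>auto simp: mult_ac\<close>)
  then obtain B :: "nat \<Rightarrow> 'a set" where B: "\<forall>a<2^d. B a \<subseteq> V \<and> card (B a) = 3 * v"
    "\<forall>a b. a < b \<and> b < 2^d \<longrightarrow> (\<forall>x\<in>B a. \<forall>y\<in>B b. \<not> ?Q x y)"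
    by (elim exE conjE)
  \<comment> \<open>By \<open>h < 2 ^ d\<close> there are at least \<open>h + 1\<close> blocks,
    enough for \<open>h\<close> halvings.\<close>
  have BW: "B a \<subseteq> W" "card (B a) = 3 * v" if "a \<le> h" for a
    using B(1)[rule_format, of a] W(3) that Cons.prems(2) by auto
  have "\<exists>a b S T. a < b \<and> b \<le> h \<and> S \<subseteq> B a \<and> T \<subseteq> B b \<and> card S = v \<and> card T = v \<and>
      (\<forall>x\<in>S. \<forall>y\<in>T. \<not> R x y)"
    using R(2)
  proof
    assume *: "\<forall>x\<in>W. card {y \<in> W. R x y} < v"
    have "\<exists>t<h. \<exists>S\<subseteq>B t. \<exists>T\<subseteq>B (Suc t). card S = v \<and> card T = v \<and> (\<forall>x\<in>S. \<forall>y\<in>T. \<not> R x y)"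
      by (rule ex_unrelated_in_consecutive_blocks[OF R(1) W(1,2) v]) (use * BW in simp_all)
    then obtain t S T where "t < h" "S \<subseteq> B t" "T \<subseteq> B (Suc t)" "card S = v" "card T = v"
      "\<forall>x\<in>S. \<forall>y\<in>T. \<not> R x y"
      by (elim exE conjE)
    then show ?thesis by (intro exI[of _ t] exI[of _ "Suc t"] exI[of _ S] exI[of _ T]) auto
  next
    assume *: "\<forall>x\<in>W. card {y \<in> W. R y x} < v"
    \<comment> \<open>For the converse the blocks are traversed backwards, so that the pair found,
      read in the original direction, again goes from a block to a later one.\<close>
    have R': "transp (\<lambda>x y. R y x)" using R(1) unfolding transp_def by blast
    have "\<exists>t<h. \<exists>S\<subseteq>B (h - t). \<exists>T\<subseteq>B (h - Suc t).
        card S = v \<and> card T = v \<and> (\<forall>x\<in>S. \<forall>y\<in>T. \<not> R y x)"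
      by (rule ex_unrelated_in_consecutive_blocks[OF R' W(1,2) v, of "\<lambda>t. B (h - t)"])
        (use * BW in simp_all)
    then obtain t S T where "t < h" "S \<subseteq> B (h - t)" "T \<subseteq> B (h - Suc t)" "card S = v" "card T = v"
      "\<forall>x\<in>S. \<forall>y\<in>T. \<not> R y x"
      by (elim exE conjE)
    then show ?thesis
      by (intro exI[of _ "h - Suc t"] exI[of _ "h - t"] exI[of _ T] exI[of _ S]) auto
  qed
  then obtain a b S T where ST: "a < b" "b \<le> h" "S \<subseteq> B a" "T \<subseteq> B b" "card S = v" "card T = v"
    "\<forall>x\<in>S. \<forall>y\<in>T. \<not> R x y"
    by (elim exE conjE)
  have "b < 2^d" "a < 2^d" using ST W(3) by auto
  then have "S \<subseteq> V" "T \<subseteq> V" using B(1) ST(3,4) by blast+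
  moreover have "\<forall>x\<in>B a. \<forall>y\<in>B b. \<not> ?Q x y"
    using B(2) ST(1) \<open>b < 2^d\<close> by blast
  then have "\<forall>x\<in>S. \<forall>y\<in>T. \<not> ?Q x y" using ST(3,4) by blast
  ultimately  show ?case using ST(5-7) by (intro exI[of _ S] exI[of _ T] conjI) auto
qed

section \<open>Sparse matrices\<close>

text \<open>Abstract setting for both symbols: \<open>M i j\<close> says that the entry is the rare
  symbol, and \<open>p\<close> and \<open>q\<close> record where the two pattern rows have it, so
  \<open>pq\<close> allows at most one column 11. The piece \<open>C k\<close> is the spare
  one.\<close>

lemma sparse_homogeneous:
  fixes M :: "nat \<Rightarrow> nat \<Rightarrow> bool" and p q :: "nat \<Rightarrow> bool" and C :: "nat \<Rightarrow> nat set"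
  assumes W: "finite W" "card W \<le> 2 ^ h" "h < 2 ^ d" "loss d (2 * Suc k) * u \<le> card W"
    and u: "u > 0" and w: "w > 0"
    and C: "\<And>b. b \<le> k \<Longrightarrow> finite (C b) \<and> card (C b) = 4 * w"
    and sparse: "\<And>i b. i \<in> W \<Longrightarrow> b \<le> k \<Longrightarrow> card {j \<in> C b. M i j} \<le> w"
    and pq: "\<And>b b'. b < k \<Longrightarrow> b' < k \<Longrightarrow> p b \<Longrightarrow> q b \<Longrightarrow> p b' \<Longrightarrow> q b' \<Longrightarrow> b = b'"
    and free: "\<And>i i' c. i \<in> W \<Longrightarrow> i' \<in> W \<Longrightarrow> i < i' \<Longrightarrow>
      (\<And>b. b < k \<Longrightarrow> c b \<in> C b) \<Longrightarrow> \<exists>b<k. \<not> (M i (c b) = p b \<and> M i' (c b) = q b)"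
  shows "\<exists>X Y b. X \<subseteq> W \<and> b \<le> k \<and> Y \<subseteq> C b \<and> card X = u \<and> w \<le> card Y \<and>
    (\<forall>i\<in>X. \<forall>j\<in>Y. \<not> M i j)"
proof (rule ccontr)
  assume no: "\<not> ?thesis"
  \<comment> \<open>The order is reversed inclusion, so the successors of \<open>x\<close> are the
    rows that vanish on \<open>C b\<close> wherever \<open>x\<close> does.\<close>
  define R where "R b x y \<longleftrightarrow> (\<forall>j\<in>C b. M y j \<longrightarrow> M x j)" for b x y
  \<comment> \<open>By sparsity \<open>x\<close> vanishes on at least \<open>3 * w\<close> columns
    of \<open>C b\<close>, and \<open>u\<close> successors would vanish there too.\<close>
  have deg: "card {y \<in> W. R b x y} < u" if "x \<in> W" "b \<le> k" for x b
  proof (rule ccontr)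
    assume "\<not> ?thesis"
    then obtain X where X: "X \<subseteq> {y \<in> W. R b x y}" "card X = u"
      by (meson not_less obtain_subset_with_card_n)
    have "C b - {j \<in> C b. M x j} \<subseteq> C b" by blast
    moreover have "w \<le> card (C b - {j \<in> C b. M x j})"
      using C[OF that(2)] sparse[OF that] by (subst card_Diff_subset) auto
    moreover have "\<forall>i\<in>X. \<forall>j\<in>C b - {j \<in> C b. M x j}. \<not> M i j"
      using X(1) by (auto simp: R_def)
    moreover have "X \<subseteq> W" using X(1) by blast
    ultimately show False using no X(2) that(2) by blast
  qed
  \<comment> \<open>The bound \<open>deg\<close> gives the first alternative of the degree condition
    for \<open>R b\<close> and the second for its converse.\<close>
  let ?Rs = "map R [0..<Suc k] @ map (\<lambda>b x y. R b y x) [0..<Suc k]"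
  have tr: "transp (R b)" "transp (\<lambda>x y. R b y x)" for b
    unfolding R_def by (auto intro!: transpI)
  have "\<exists>S\<subseteq>W. \<exists>T\<subseteq>W. card S = u \<and> card T = u \<and> (\<forall>x\<in>S. \<forall>y\<in>T. \<not> (\<exists>Q\<in>set ?Rs. Q x y))"
  proof (rule ex_unrelated[OF W(1-3) u])
    fix Q assume "Q \<in> set ?Rs"
    then have "\<exists>b\<in>set [0..<Suc k]. Q = R b \<or> Q = (\<lambda>x y. R b y x)"
      by (simp only: set_append set_map Un_iff image_iff) blast
    then obtain b where b: "b \<in> set [0..<Suc k]" and Q: "Q = R b \<or> Q = (\<lambda>x y. R b y x)"
      by blast
    from b have "b \<le> k" by auto
    with Q show "transp Q \<and>
        ((\<forall>x\<in>W. card {y \<in> W. Q x y} < u) \<or> (\<forall>x\<in>W. card {y \<in> W. Q y x} < u))"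
      using tr deg by auto
  qed (use W(4) in \<open>auto simp: mult_2\<close>)
  then obtain S T where ST: "S \<subseteq> W" "T \<subseteq> W" "card S = u" "card T = u"
    "\<forall>x\<in>S. \<forall>y\<in>T. \<not> (\<exists>Q\<in>set ?Rs. Q x y)"
    by (elim exE conjE)
  have inc: "\<not> R b x y" "\<not> R b y x" if "x \<in> S" "y \<in> T" "b \<le> k" for x y b
  proof -
    have b: "b \<in> set [0..<Suc k]" using that(3) by auto
    have 1: "R b \<in> set ?Rs"
      unfolding set_append set_map by (intro UnI1 imageI b)
    have 2: "(\<lambda>x y. R b y x) \<in> set ?Rs"
      unfolding set_append set_map by (rule UnI2, rule image_eqI[OF refl b])
    have no: "\<not> (\<exists>Q\<in>set ?Rs. Q x y)" by (rule ST(5)[THEN bspec, THEN bspec, OF that(1,2)])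
    show "\<not> R b x y"
      using no bexI[of "\<lambda>Q. Q x y", OF _ 1] by (rule contrapos_nn)
    show "\<not> R b y x"
      using no bexI[of "\<lambda>Q. Q x y", OF _ 2] by (rule contrapos_nn)
  qed
  have "\<exists>m\<le>k. \<forall>b<k. p b \<longrightarrow> q b \<longrightarrow> b = m"
  proof (cases "\<exists>b<k. p b \<and> q b")
    case True
    then show ?thesis using pq by (metis less_imp_le)
  qed auto
  \<comment> \<open>\<open>m\<close> is the column 11 of the pattern, or the spare index \<open>k\<close> if there is none\<close>
  then obtain m where m: "m \<le> k" "\<And>b. b < k \<Longrightarrow> p b \<Longrightarrow> q b \<Longrightarrow> b = m"
    by blast
  have pattern: False
    if xy: "x \<in> W" "y \<in> W" "x < y" and R: "\<And>b. b \<le> k \<Longrightarrow> \<not> R b x y \<and> \<not> R b y x"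
      and j: "j \<in> C m" "M x j" "M y j" for x y j
  proof -
    have "\<exists>j. j \<in> C b \<and> M x j = p b \<and> M y j = q b" if b: "b < k" for b
    proof -
      consider "p b" "q b" | "p b \<noteq> q b" | "\<not> p b" "\<not> q b" by blast
      then show ?thesis
      proof cases
        case 1
        then show ?thesis using m(2)[OF b] j by auto
      next
        case 2
        then show ?thesis using R[of b] b unfolding R_def by (cases "p b") auto
      next
        case 3
        \<comment> \<open>Two sparse rows cover at most \<open>2 * w\<close> of the
          \<open>4 * w\<close> columns, which leaves a common zero.\<close>
        have "card ({j \<in> C b. M x j} \<union> {j \<in> C b. M y j}) \<le> 2 * w"
          using card_Un_le[of "{j \<in> C b. M x j}" "{j \<in> C b. M y j}"]
            sparse[OF xy(1), of b] sparse[OF xy(2), of b] b by linarith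
        then have "C b \<noteq> {j \<in> C b. M x j} \<union> {j \<in> C b. M y j}"
          using C[of b] b w by (auto dest!: arg_cong[where f = card])
        then show ?thesis using 3 by auto
      qed
    qed
    then obtain c where "\<And>b. b < k \<Longrightarrow> c b \<in> C b \<and> M x (c b) = p b \<and> M y (c b) = q b"
      by metis
    then show False using free[OF xy, of c] by blast
  qed
  have disj: "\<not> (M x j \<and> M y j)" if "x \<in> S" "y \<in> T" "j \<in> C m" for x y j
  proof
    assume M: "M x j \<and> M y j"
    \<comment> \<open>Reflexivity excludes equal rows; as incomparability is symmetric, either row
      may be the upper one of the pattern.\<close>
    have "x \<noteq> y" using inc(1)[OF that(1,2), of 0] by (auto simp: R_def)
    then show False
      using pattern[of x y j] pattern[of y x j] inc[OF that(1,2)] M that ST(1,2)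
      by (cases x y rule: linorder_cases) blast+
  qed
  \<comment> \<open>The two families have disjoint supports among \<open>4 * w\<close> columns, so
    one family misses at least \<open>2 * w\<close> of them.\<close>
  define U where "U Z = {j \<in> C m. \<exists>x\<in>Z. M x j}" for Z
  have "U S \<inter> U T = {}" using disj by (auto simp: U_def)
  then have "card (U S) + card (U T) = card (U S \<union> U T)"
    using C[OF m(1)] by (intro card_Un_disjoint[symmetric]) (auto simp: U_def)
  also have "\<dots> \<le> 4 * w"
    using C[OF m(1)] card_mono[of "C m" "U S \<union> U T"] by (auto simp: U_def)
  finally have "card (U S) \<le> 2 * w \<or> card (U T) \<le> 2 * w" by linarith
  then obtain Z where Z: "Z \<subseteq> W" "card Z = u" "card (U Z) \<le> 2 * w"
    using ST(1-4) by blast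
  have "w \<le> card (C m - U Z)"
    using C[OF m(1)] Z(3) by (subst card_Diff_subset) (auto simp: U_def)
  moreover have "\<forall>i\<in>Z. \<forall>j\<in>C m - U Z. \<not> M i j" by (auto simp: U_def)
  moreover have "C m - U Z \<subseteq> C m" by blast
  ultimately show False using no Z(1,2) m(1) by blast
qed

section \<open>Matrices\<close>

text \<open>Homogeneity passes to subsets, so larger sets may be cut down to the exact cardinalities
  of the definition.\<close>

lemma has_homogeneous_submatrixI:
  assumes "X \<subseteq> {..<dim_row A}" "Y \<subseteq> {..<dim_col A}" "s \<le> card X" "t \<le> card Y"
    and v: "\<And>i j. i \<in> X \<Longrightarrow> j \<in> Y \<Longrightarrow> A $$ (i, j) = v"
  shows "has_homogeneous_submatrix A s t"
proof -
  obtain X' where X': "X' \<subseteq> X" "card X' = s" using assms(3) by (meson obtain_subset_with_card_n)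
  obtain Y' where Y': "Y' \<subseteq> Y" "card Y' = t" using assms(4) by (meson obtain_subset_with_card_n)
  have eq: "{i. i < dim_row A \<and> i \<in> X'} = X'" "{j. j < dim_col A \<and> j \<in> Y'} = Y'"
    using X' Y' assms by auto
  have "x = v" if x: "x \<in> elements_mat (submatrix A X' Y')" for x
  proof -
    obtain i j where ij: "i < dim_row (submatrix A X' Y')" "j < dim_col (submatrix A X' Y')"
      "x = submatrix A X' Y' $$ (i, j)"
      using elements_matD[OF x] by blast
    then have ij': "i < card X'" "j < card Y'" by (simp_all add: dim_submatrix eq)
    have "x = A $$ (pick X' i, pick Y' j)"
      unfolding ij(3) by (rule submatrix_index) (use ij' in \<open>simp_all add: eq\<close>)
    then show ?thesis
      using v[of "pick X' i" "pick Y' j"] pick_in_set_le[OF ij'(1)] pick_in_set_le[OF ij'(2)] X' Y'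
      by blast
  qed
  then have "homogeneous (submatrix A X' Y')" unfolding homogeneous_def by blast
  moreover have "X' \<subseteq> {..<dim_row A}" "Y' \<subseteq> {..<dim_col A}" using X' Y' assms by auto
  ultimately show ?thesis
    unfolding has_homogeneous_submatrix_def using X'(2) Y'(2) by blast
qed

lemma zero_one_mat_index:
  assumes "zero_one_mat A" "A \<in> carrier_mat m n" "i < m" "j < n"
  shows "A $$ (i, j) = 0 \<or> A $$ (i, j) = 1"
  using elements_matI[OF assms(2-4) refl] assms(1) by (auto simp: zero_one_mat_def)

lemma equal_columns_unique:
  assumes "P \<in> carrier_mat 2 k" "\<not> has_homogeneous_submatrix P 2 2"
    and "b < k" "b' < k"
    and "P $$ (0, b) = v" "P $$ (1, b) = v" "P $$ (0, b') = v" "P $$ (1, b') = v"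
  shows "b = b'"
proof (rule ccontr)
  assume "b \<noteq> b'"
  have "has_homogeneous_submatrix P 2 2"
    by (rule has_homogeneous_submatrixI[of "{0, 1}" _ "{b, b'}" _ _ v])
      (use assms \<open>b \<noteq> b'\<close> in auto)
  then show False using assms(2) by simp
qed

text \<open>Choosing one column from each of several blocks lying in order makes \<open>c\<close>
  strictly increasing, so that only the entries have to be matched.\<close>

lemma contains_two_row_matI:
  assumes "A \<in> carrier_mat n n" "P \<in> carrier_mat 2 k" "i < i'" "i' < n"
    and c: "\<And>b. b < k \<Longrightarrow> c b \<in> C b"
    and C: "\<And>b. b < k \<Longrightarrow> C b \<subseteq> {..<n}"
      "\<And>b b' j j'. b < b' \<Longrightarrow> b' < k \<Longrightarrow> j \<in> C b \<Longrightarrow> j' \<in> C b' \<Longrightarrow> j < j'"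
    and eq: "\<And>b. b < k \<Longrightarrow> A $$ (i, c b) = P $$ (0, b) \<and> A $$ (i', c b) = P $$ (1, b)"
  shows "contains_mat A P"
  unfolding contains_mat_def
proof (intro exI conjI)
  let ?r = "\<lambda>a::nat. if a = 0 then i else i'"
  show "strict_mono_on {..<dim_row P} ?r"
    using assms(2,3) by (auto simp: strict_mono_on_def)
  show "?r ` {..<dim_row P} \<subseteq> {..<dim_row A}" using assms(1-4) by auto
  show "strict_mono_on {..<dim_col P} c"
  proof (rule strict_mono_onI)
    fix b b' assume b: "b \<in> {..<dim_col P}" "b' \<in> {..<dim_col P}" "b < b'"
    then have k: "b < k" "b' < k" using assms(2) by auto
    show "c b < c b'" by (rule C(2)[OF b(3) k(2) c[OF k(1)] c[OF k(2)]])
  qed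
  show "c ` {..<dim_col P} \<subseteq> {..<dim_col A}" using C(1) c assms(1,2) by blast
  show "\<forall>a<dim_row P. \<forall>b<dim_col P. A $$ (?r a, c b) = P $$ (a, b)"
    using eq assms(2) by (auto simp: less_2_cases_iff)
qed

text \<open>The majority symbol of row 0 is taken. This serves those \<open>n\<close> for which only
  one row is claimed.\<close>

lemma one_row_homogeneous:
  assumes A: "A \<in> carrier_mat n n" "zero_one_mat A" and "n \<ge> 1" and t: "2 * t \<le> n + 1"
  shows "has_homogeneous_submatrix A 1 t"
proof -
  let ?Y = "\<lambda>v. {j \<in> {..<n}. A $$ (0, j) = v}"
  have "?Y 0 \<union> ?Y 1 = {..<n}"
    using zero_one_mat_index[OF A(2,1), of 0] \<open>n \<ge> 1\<close> by force
  then have "n \<le> card (?Y 0) + card (?Y 1)"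
    using card_Un_le[of "?Y 0" "?Y 1"] by simp
  then have "t \<le> card (?Y 0) \<or> t \<le> card (?Y 1)" using t by linarith
  then obtain v where v: "t \<le> card (?Y v)" by blast
  show ?thesis
    by (rule has_homogeneous_submatrixI[of "{0}" _ "?Y v" _ _ v]) (use A \<open>n \<ge> 1\<close> v in auto)
qed

section \<open>Division of the columns into consecutive blocks\<close>

lemma block_subset:
  fixes a b m l :: nat
  assumes "b < m"
  shows "{a + b * l..<a + Suc b * l} \<subseteq> {a..<a + m * l}"
proof -
  have "Suc b * l \<le> m * l" using assms by (intro mult_le_mono1) simp
  then show ?thesis by auto
qed

lemma block_less:
  fixes a b b' l :: nat
  assumes "b < b'" "j \<in> {a + b * l..<a + Suc b * l}" "j' \<in> {a + b' * l..<a + Suc b' * l}"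
  shows "j < j'"
proof -
  have "Suc b * l \<le> b' * l" using assms(1) by (intro mult_le_mono1) simp
  then show ?thesis using assms(2,3) by auto
qed

text \<open>The columns are cut into \<open>Suc k\<close> blocks of \<open>Suc k\<close> pieces of
  length \<open>4 * w\<close>, which explains the bound on \<open>w\<close>. In the sparse case the
  first half of the rows falls into \<open>2 * Suc k\<close> classes by block and rare symbol, which
  explains \<open>size\<close>.\<close>

lemma free_homogeneous:
  fixes A P :: "nat mat"
  assumes P: "P \<in> carrier_mat 2 k" "zero_one_mat P" "\<not> has_homogeneous_submatrix P 2 2"
    and A: "A \<in> carrier_mat n n" "zero_one_mat A" "mat_free P A"
    and n: "n \<le> 2 ^ h" "h < 2 ^ d" and u: "u > 0" and w: "w > 0" "4 * (Suc k)\<^sup>2 * w \<le> n"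
    and size: "2 * Suc k * (loss d (2 * Suc k) * u) \<le> n div 2"
  shows "has_homogeneous_submatrix A u w"
proof -
  let ?K = "Suc k"
  define big where "big b = {0 + b * (?K * (4 * w))..<0 + Suc b * (?K * (4 * w))}" for b
  define sub where
    "sub b b' = {b * (?K * (4 * w)) + b' * (4 * w)..<b * (?K * (4 * w)) + Suc b' * (4 * w)}" for b b'
  have big_range: "big b \<subseteq> {..<n}" if "b < ?K" for b
  proof -
    have "?K * (?K * (4 * w)) \<le> n" using w(2) by (simp only: power2_eq_square mult_ac)
    then have "{0..<0 + ?K * (?K * (4 * w))} \<subseteq> {..<n}" by auto
    with block_subset[OF that, of 0 "?K * (4 * w)"] show ?thesis
      unfolding big_def by (rule subset_trans)
  qed
  have sub_big: "sub b b' \<subseteq> big b" if "b' < ?K" for b b'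
    using block_subset[OF that, of "b * (?K * (4 * w))" "4 * w"]
    unfolding sub_def big_def by (simp add: add.commute)
  have big_less: "j < j'" if "b < b'" "j \<in> big b" "j' \<in> big b'" for b b' j j'
    using block_less[OF that(1)] that(2,3) unfolding big_def by blast
  have sub_less: "j < j'" if "b < b'" "j \<in> sub a b" "j' \<in> sub a b'" for a b b' j j'
    using block_less[OF that(1)] that(2,3) unfolding sub_def by blast
  have fin: "finite (big b)" for b by (simp add: big_def)
  have A01: "A $$ (i, j) = 0 \<or> A $$ (i, j) = 1" if "i < n" "j < n" for i j
    using zero_one_mat_index[OF A(2,1) that] .
  have P01: "P $$ (i, j) = 0 \<or> P $$ (i, j) = 1" if "i < 2" "j < k" for i j
    using zero_one_mat_index[OF P(2,1) that] .
  define few where "few i b x \<longleftrightarrow> card {j \<in> big b. A $$ (i, j) = x} \<le> w" for i b x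
  show ?thesis
  proof (cases "\<exists>i<n div 2. \<forall>b<?K. \<forall>x\<in>{0, 1}. \<not> few i b x")
    case True
    then obtain i where i: "i < n div 2" "\<And>b x. b < ?K \<Longrightarrow> x \<in> {0, 1} \<Longrightarrow> \<not> few i b x"
      by blast
    have "\<exists>b<k. \<forall>j\<in>big b. A $$ (i, j) = P $$ (0, b) \<longrightarrow> A $$ (i', j) \<noteq> P $$ (1, b)"
      if i': "i' \<in> {n div 2..<n}" for i'
    proof (rule ccontr)
      assume "\<not> ?thesis"
      then have "\<forall>b. b < k \<longrightarrow> (\<exists>j. j \<in> big b \<and> A $$ (i, j) = P $$ (0, b) \<and> A $$ (i', j) = P $$ (1, b))"
        by blast
      then obtain c where c: "\<And>b. b < k \<Longrightarrow>
          c b \<in> big b \<and> A $$ (i, c b) = P $$ (0, b) \<and> A $$ (i', c b) = P $$ (1, b)"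
        by metis
      have "contains_mat A P"
        by (rule contains_two_row_matI[OF A(1) P(1), of i i' c big])
          (use c i(1) i' big_less big_range in auto)
      then show False using A(3) by (simp add: mat_free_def)
    qed
    then obtain g where g: "\<And>i'. i' \<in> {n div 2..<n} \<Longrightarrow> g i' < k \<and>
        (\<forall>j\<in>big (g i'). A $$ (i, j) = P $$ (0, g i') \<longrightarrow> A $$ (i', j) \<noteq> P $$ (1, g i'))"
      by metis
    \<comment> \<open>The range has \<open>?K\<close> values so as to be nonempty even for
      \<open>k = 0\<close>; nonemptiness of the fibre later gives \<open>b < k\<close>.\<close>
    have "\<exists>b\<in>{..<?K}. u \<le> card {i' \<in> {n div 2..<n}. g i' = b}"
    proof (rule large_fibre)
      have "u \<le> loss d (2 * ?K) * u" using loss_pos[of d "2 * ?K"] by (cases "loss d (2 * ?K)") auto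
      then have "?K * u \<le> 2 * ?K * (loss d (2 * ?K) * u)" by (intro mult_le_mono) auto
      then have "?K * u \<le> n div 2" using size by linarith
      then show "card {..<?K} * u \<le> card {n div 2..<n}" unfolding card_lessThan card_atLeastLessThan
        by linarith
      show "g ` {n div 2..<n} \<subseteq> {..<?K}" using g by (fastforce intro: less_SucI)
    qed auto
    then obtain b where b: "u \<le> card {i' \<in> {n div 2..<n}. g i' = b}" by blast
    define X where "X = {i' \<in> {n div 2..<n}. g i' = b}"
    define Y where "Y = {j \<in> big b. A $$ (i, j) = P $$ (0, b)}"
    have "X \<noteq> {}" using b u unfolding X_def[symmetric] by auto
    then have bk: "b < k" using g by (auto simp: X_def)
    show ?thesis
    \<comment> \<open>On \<open>Y\<close> row \<open>i\<close> agrees with the upper pattern entry,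
      so rows of \<open>X\<close> must show the symbol opposite to the lower one.\<close>
    proof (rule has_homogeneous_submatrixI[of X _ Y _ _ "1 - P $$ (1, b)"])
      show "X \<subseteq> {..<dim_row A}" using A(1) by (auto simp: X_def)
      show "Y \<subseteq> {..<dim_col A}" using A(1) big_range[of b] bk by (auto simp: Y_def)
      show "u \<le> card X" using b by (simp add: X_def)
      show "w \<le> card Y"
        using i(2)[of b "P $$ (0, b)"] P01[of 0 b] bk by (auto simp: few_def Y_def)
      fix i' j assume *: "i' \<in> X" "j \<in> Y"
      then have "A $$ (i', j) \<noteq> P $$ (1, b)" using g[of i'] by (auto simp: X_def Y_def)
      moreover have "i' < n" "j < n" using * big_range[of b] bk by (auto simp: X_def Y_def)
      ultimately show "A $$ (i', j) = 1 - P $$ (1, b)"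
        using A01[of i' j] P01[of 1 b] bk by auto
    qed
  next
    case False
    then have "\<forall>i. i < n div 2 \<longrightarrow> (\<exists>y. y \<in> {..<?K} \<times> {0, 1} \<and> few i (fst y) (snd y))"
      by fastforce
    then obtain g where g: "\<And>i. i < n div 2 \<Longrightarrow> g i \<in> {..<?K} \<times> {0, 1} \<and> few i (fst (g i)) (snd (g i))"
      by metis
    have "\<exists>y\<in>{..<?K} \<times> {0, 1}. loss d (2 * ?K) * u \<le> card {i \<in> {..<n div 2}. g i = y}"
    proof (rule large_fibre)
      show "g ` {..<n div 2} \<subseteq> {..<?K} \<times> {0, 1}" using g by blast
      have "card ({..<?K} \<times> {0, 1::nat}) = 2 * ?K" by (simp add: card_cartesian_product)
      then show "card ({..<?K} \<times> {0, 1::nat}) * (loss d (2 * ?K) * u) \<le> card {..<n div 2}"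
        using size by (simp only: card_lessThan)
    qed auto
    then obtain a x where ax: "a < ?K" "x \<in> {0, 1}"
      "loss d (2 * ?K) * u \<le> card {i \<in> {..<n div 2}. g i = (a, x)}"
      by auto
    define W where "W = {i \<in> {..<n div 2}. g i = (a, x)}"
    have Wn: "W \<subseteq> {..<n}" by (auto simp: W_def)
    have sub_range: "sub a b \<subseteq> {..<n}" if "b \<le> k" for b
      using sub_big[of b a] big_range[OF ax(1)] that by auto
    have "\<exists>X Y b. X \<subseteq> W \<and> b \<le> k \<and> Y \<subseteq> sub a b \<and> card X = u \<and> w \<le> card Y \<and>
        (\<forall>i\<in>X. \<forall>j\<in>Y. \<not> A $$ (i, j) = x)"
    \<comment> \<open>Recording equality with the rare symbol \<open>x\<close> treats
      \<open>x = 0\<close> and \<open>x = 1\<close> without passing to the complement.\<close>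
    proof (rule sparse_homogeneous[where p = "\<lambda>b. P $$ (0, b) = x" and q = "\<lambda>b. P $$ (1, b) = x"])
      show "finite W" by (simp add: W_def)
      show "card W \<le> 2 ^ h" using card_mono[OF _ Wn] n(1) by simp
      show "h < 2 ^ d" "u > 0" "w > 0" by fact+
      show "loss d (2 * ?K) * u \<le> card W" using ax(3) by (simp add: W_def)
      show "finite (sub a b) \<and> card (sub a b) = 4 * w" for b by (simp add: sub_def)
      show "card {j \<in> sub a b. A $$ (i, j) = x} \<le> w" if "i \<in> W" "b \<le> k" for i b
      proof -
        have "card {j \<in> sub a b. A $$ (i, j) = x} \<le> card {j \<in> big a. A $$ (i, j) = x}"
          using sub_big[of b a] that(2) fin by (intro card_mono) auto
        also have "\<dots> \<le> w" using g[of i] that(1) by (auto simp: W_def few_def)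
        finally show ?thesis .
      qed
      show "b = b'" if "b < k" "b' < k" "P $$ (0, b) = x" "P $$ (1, b) = x"
        "P $$ (0, b') = x" "P $$ (1, b') = x" for b b'
        using equal_columns_unique[OF P(1,3) that] .
      show "\<exists>b<k. \<not> ((A $$ (i, c b) = x) = (P $$ (0, b) = x) \<and> (A $$ (i', c b) = x) = (P $$ (1, b) = x))"
        if i: "i \<in> W" "i' \<in> W" "i < i'" and c: "\<And>b. b < k \<Longrightarrow> c b \<in> sub a b" for i i' c
      proof (rule ccontr)
        assume neg: "\<not> ?thesis"
        have "A $$ (i, c b) = P $$ (0, b) \<and> A $$ (i', c b) = P $$ (1, b)" if "b < k" for b
        proof -
          have "c b < n" using c[OF that] sub_range[of b] that by auto
          moreover have "i < n" "i' < n" using i(1,2) Wn by auto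
          ultimately have "A $$ (i, c b) = 0 \<or> A $$ (i, c b) = 1" "A $$ (i', c b) = 0 \<or> A $$ (i', c b) = 1"
            using A01 by blast+
          moreover have "P $$ (0, b) = 0 \<or> P $$ (0, b) = 1" "P $$ (1, b) = 0 \<or> P $$ (1, b) = 1"
            using P01 that by simp_all
          moreover have "(A $$ (i, c b) = x) = (P $$ (0, b) = x)" "(A $$ (i', c b) = x) = (P $$ (1, b) = x)"
            using neg that by blast+
          ultimately show ?thesis using ax(2) by auto
        qed
        then have "contains_mat A P"
          using c i Wn sub_range sub_less
          by (intro contains_two_row_matI[OF A(1) P(1), of i i' c "sub a"]) auto
        then show False using A(3) by (simp add: mat_free_def)
      qed
    qed
    then obtain X Y b where XY: "X \<subseteq> W" "b \<le> k" "Y \<subseteq> sub a b" "card X = u" "w \<le> card Y"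
      "\<And>i j. i \<in> X \<Longrightarrow> j \<in> Y \<Longrightarrow> A $$ (i, j) \<noteq> x"
      by blast
    show ?thesis
    proof (rule has_homogeneous_submatrixI[of X _ Y _ _ "1 - x"])
      show "X \<subseteq> {..<dim_row A}" "Y \<subseteq> {..<dim_col A}"
        using A(1) XY(1-3) Wn sub_range[of b] by auto
      show "u \<le> card X" "w \<le> card Y" using XY by auto
      fix i j assume ij: "i \<in> X" "j \<in> Y"
      then have "i < n" "j < n" using XY(1,3) Wn sub_range[OF XY(2)] by auto
      then show "A $$ (i, j) = 1 - x"
        using A01[of i j] XY(6)[OF ij] ax(2) by auto
    qed
  qed
qed

section \<open>Asymptotics\<close>

text \<open>With \<open>h = floorlog 2 n\<close> this is a \<open>d\<close> that satisfies
  \<open>h < 2 ^ d\<close>, while \<open>n \<le> 2 ^ h\<close>.\<close>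

definition iterated_log :: "nat \<Rightarrow> nat" where
  "iterated_log n = floorlog 2 (floorlog 2 n)"

lemma iterated_log_le:
  assumes "n \<ge> 2"
  shows "real (iterated_log n) \<le> log 2 (log 2 n + 1) + 1"
proof -
  have *: "real (floorlog 2 m) \<le> log 2 m + 1" if "m > 0" for m
    using that by (simp add: floorlog_def)
  have pos: "floorlog 2 n > 0" using assms by (simp add: floorlog_def)
  have "log 2 (floorlog 2 n) \<le> log 2 (log 2 n + 1)"
    using *[of n] pos assms by (subst log_le_cancel_iff) auto
  then show ?thesis using *[OF pos] unfolding iterated_log_def by linarith
qed

text \<open>The logarithm of the loss is at most a fixed power of a doubly logarithmic quantity,
  hence negligible against \<open>ln n\<close>.\<close>

lemma ln_loss_negligible:
  "(\<lambda>n. ln (C * real (loss (iterated_log n) r)) / ln (real n)) \<longlonglongrightarrow> 0" if "C \<ge> 1"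
proof (rule tendsto_sandwich[OF _ _ tendsto_const])
  let ?g = "\<lambda>n. (ln C + (2 + log 2 (log 2 (real n) + 1)) ^ r * ln 3) / ln (real n)"
  have ge1: "1 * 1 \<le> C * real (loss (iterated_log n) r)" for n
    using that loss_pos[of "iterated_log n" r] by (intro mult_mono) auto
  show "\<forall>\<^sub>F n in sequentially. 0 \<le> ln (C * real (loss (iterated_log n) r)) / ln (real n)"
    using eventually_ge_at_top[of 1]
  proof eventually_elim
    case (elim n)
    then show ?case using ge1[of n] by (intro divide_nonneg_nonneg ln_ge_zero) auto
  qed
  show "\<forall>\<^sub>F n in sequentially. ln (C * real (loss (iterated_log n) r)) / ln (real n) \<le> ?g n"
    using eventually_ge_at_top[of 2]
  proof eventually_elim
    case (elim n)
    have L: "real (loss (iterated_log n) r) \<ge> 1" using loss_pos[of "iterated_log n" r] by simp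
    have "ln (real (loss (iterated_log n) r)) \<le> ln (real (3 ^ ((1 + iterated_log n) ^ r)))"
      using loss_le[of "iterated_log n" r] L by (subst ln_le_cancel_iff) (auto simp del: of_nat_power)
    also have "\<dots> = (1 + real (iterated_log n)) ^ r * ln 3"
      by (simp add: ln_realpow)
    also have "\<dots> \<le> (2 + log 2 (log 2 (real n) + 1)) ^ r * ln 3"
      using iterated_log_le[OF elim] by (intro mult_right_mono power_mono) auto
    finally have "ln (C * real (loss (iterated_log n) r)) \<le> ln C + (2 + log 2 (log 2 (real n) + 1)) ^ r * ln 3"
      using that L by (simp add: ln_mult)
    moreover have "ln (real n) > 0" using elim by simp
    ultimately show ?case by (simp add: divide_right_mono)
  qed
  show "?g \<longlonglongrightarrow> 0" by real_asymp
qed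

section \<open>Choice of the parameters and passage to the asymptotic form\<close>

theorem theorem1p2:
  fixes P :: "nat mat" and k :: nat
  assumes "P \<in> carrier_mat 2 k"
    and "zero_one_mat P"
    and "\<not> has_homogeneous_submatrix P 2 2"
  shows "\<exists>c::real. c > 0 \<and> (\<exists>f :: nat \<Rightarrow> real.
    (\<exists>e :: nat \<Rightarrow> real. e \<in> o(\<lambda>_. 1) \<and> (\<forall>n\<ge>1. f n = real n powr (1 - e n))) \<and>
    (\<forall>n\<ge>1. \<forall>A :: nat mat. A \<in> carrier_mat n n \<and> zero_one_mat A \<and> mat_free P A \<longrightarrow>
      has_homogeneous_submatrix A (nat \<lceil>f n\<rceil>) (nat \<lceil>c * real n\<rceil>)))"
proof -
  let ?K = "Suc k"
  \<comment> \<open>In the constant 8, a factor 4 pays for the width \<open>4 * w\<close> of the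
    pieces and a factor 2 for rounding up.\<close>
  define c :: real where "c = 1 / (8 * (real ?K)\<^sup>2)"
  \<comment> \<open>The factor 16 leaves room for the \<open>2 * ?K\<close> classes, for halving the
    rows and for rounding up \<open>f n\<close>.\<close>
  define L where "L n = 16 * real ?K * real (loss (iterated_log n) (2 * ?K))" for n
  define e0 where "e0 n = ln (L n) / ln (real n)" for n
  \<comment> \<open>The default 1 makes \<open>f n = 1\<close> where \<open>n\<close> is small or
    \<open>n / L n\<close> would be below 1, which happens for finitely many \<open>n\<close>
    only.\<close>
  define e where "e n = (if 8 * ?K\<^sup>2 \<le> n \<and> e0 n \<le> 1 then e0 n else 1)" for n
  define f where "f n = real n powr (1 - e n)" for n
  have "e0 \<longlonglongrightarrow> 0"
    unfolding e0_def L_def by (rule ln_loss_negligible) simp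
  then have "\<forall>\<^sub>F n in sequentially. e0 n < 1" by (rule order_tendstoD) simp
  then have "\<forall>\<^sub>F n in sequentially. e0 n = e n"
    using eventually_ge_at_top[of "8 * ?K\<^sup>2"] by eventually_elim (simp add: e_def)
  then have "e \<longlonglongrightarrow> 0" using \<open>e0 \<longlonglongrightarrow> 0\<close> by (rule Lim_transform_eventually[rotated])
  then have e: "e \<in> o(\<lambda>_. 1)" by (intro smalloI_tendsto) auto
  have K1: "(real ?K)\<^sup>2 \<ge> 1" by (intro one_le_power) simp
  have c: "0 < c" "c \<le> 1 / 8" unfolding c_def using K1 by (auto simp: field_simps)
  have "has_homogeneous_submatrix A (nat \<lceil>f n\<rceil>) (nat \<lceil>c * real n\<rceil>)"
    if n: "n \<ge> 1" and A: "A \<in> carrier_mat n n" "zero_one_mat A" "mat_free P A" for n A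
  proof (cases "8 * ?K\<^sup>2 \<le> n \<and> e0 n \<le> 1")
    case False
    then have "e n = 1" by (auto simp: e_def)
    then have "nat \<lceil>f n\<rceil> = 1" using n by (simp add: f_def)
    moreover have "c * real n \<le> real n / 8" using mult_right_mono[OF c(2), of "real n"] by simp
    \<comment> \<open>For \<open>n = 1\<close> one column is claimed, which is why the bound is
      \<open>n + 1\<close> and not \<open>n\<close>.\<close>
    then have "2 * nat \<lceil>c * real n\<rceil> \<le> n + 1" using c n by linarith
    ultimately show ?thesis using one_row_homogeneous[OF A(1,2) n] by simp
  next
    case True
    have "1 \<le> ?K\<^sup>2" by simp
    then have n8: "n \<ge> 8" using True by linarith
    have lnn: "ln (real n) > 0" using n8 by simp
    have loss1: "real (loss (iterated_log n) (2 * ?K)) \<ge> 1"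
      using loss_pos[of "iterated_log n" "2 * ?K"] by linarith
    then have L0: "L n > 0" unfolding L_def by simp
    have "f n = real n powr 1 / real n powr e0 n" using True by (simp add: f_def e_def powr_diff)
    also have "real n powr e0 n = L n" using n8 lnn L0 by (simp add: powr_def e0_def)
    finally have f: "f n = real n / L n" using n8 by simp
    have f1: "f n \<ge> 1" unfolding f_def using True n by (simp add: e_def ge_one_powr_ge_zero)
    define u where "u = nat \<lceil>f n\<rceil>"
    define w where "w = nat \<lceil>c * real n\<rceil>"
    have u: "u > 0" "real u \<le> 2 * f n" unfolding u_def using f1 by linarith+
    have w0: "w > 0" unfolding w_def using c n by simp
    have cn: "8 * (real ?K)\<^sup>2 * (c * real n) = real n" unfolding c_def using K1 by simp
    have "8 * real (?K\<^sup>2) \<le> real n" using True by (metis of_nat_le_iff of_nat_mult of_nat_numeral)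
    then have "1 \<le> c * real n" unfolding c_def using K1 by (simp add: field_simps)
    then have "real w \<le> 2 * (c * real n)" unfolding w_def by linarith
    then have "4 * (real ?K)\<^sup>2 * real w \<le> 4 * (real ?K)\<^sup>2 * (2 * (c * real n))"
      by (intro mult_left_mono) auto
    also have "\<dots> = real n" using cn by simp
    finally have w1: "4 * ?K\<^sup>2 * w \<le> n"
      by (simp only: flip: of_nat_le_iff[where 'a = real]) simp
    have "2 * (2 * real ?K * (real (loss (iterated_log n) (2 * ?K)) * real u)) = L n / 4 * real u"
      by (simp add: L_def)
    also have "\<dots> \<le> L n / 4 * (2 * f n)" using u(2) L0 by (intro mult_left_mono) auto
    also have "\<dots> = real n / 2" using L0 by (simp add: f)
    finally have "real (2 * (2 * ?K * (loss (iterated_log n) (2 * ?K) * u))) \<le> real n"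
      by (simp only: of_nat_mult of_nat_numeral)
    then have "2 * (2 * ?K * (loss (iterated_log n) (2 * ?K) * u)) \<le> n"
      by (simp only: of_nat_le_iff)
    then have size: "2 * ?K * (loss (iterated_log n) (2 * ?K) * u) \<le> n div 2" by linarith
    have h: "n \<le> 2 ^ floorlog 2 n" "floorlog 2 n < 2 ^ iterated_log n"
      unfolding iterated_log_def using floorlog_leD[of 2 _ "floorlog 2 _"] by (auto intro: less_imp_le)
    show ?thesis
      using free_homogeneous[OF assms A h u(1) w0 w1 size] unfolding u_def w_def .
  qed
  then show ?thesis using c(1) e f_def by blast
qed

end
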